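(* Let $n \geq 5$ and $k \geq 2$ be integers with $2k<n$ and $\gcd(n,k)=1$. Then $$5 \leq \sigma^{-}(P(n,k)) \leq n.$$
   Context: For $n \geq 3$, $k \geq 1$ with $2k<n$, the generalized Petersen graph $P(n,k)$ has vertex set $\{u_i, v_i : i=0,1,\dots,n-1\}$ and edge set $\{u_iu_{i+1},\ u_iv_i,\ v_iv_{i+k} : i=0,\dots,n-1\}$, subscripts read modulo $n$. For a simple connected graph $G$ of order $N$, the \textbf{rna} number $\sigma^{-}(G)$ is the minimum, over all bijections $f: V(G)\to\{1,2,\dots,N\}$, of the number of edges $uv$ of $G$ such that $f(u)$ and $f(v)$ have different parity. *)

theory Defs
  imports Main
begin

text \<open>A simple graph is a pair of a vertex set and a set of edges, an edge being the
  two-element set of its ends.\<close>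

type_synonym 'a graph = "'a set \<times> 'a set set"

definition simple_graph :: "'a graph \<Rightarrow> bool" where
  "simple_graph G \<longleftrightarrow> finite (fst G) \<and> (\<forall>e \<in> snd G. e \<subseteq> fst G \<and> card e = 2)"

definition parity_cut :: "'a graph \<Rightarrow> ('a \<Rightarrow> nat) \<Rightarrow> 'a set set" where
  "parity_cut G f = {e \<in> snd G. \<exists>u v. e = {u, v} \<and> even (f u) \<noteq> even (f v)}"

text \<open>The set under the minimum is finite and nonempty whenever the graph is finite
  (\<open>rna_attained\<close> and \<open>rna_le\<close> below).\<close>

definition rna :: "'a graph \<Rightarrow> nat" where
  "rna G = Min {card (parity_cut G f) | f. bij_betw f (fst G) {1..card (fst G)}}"

datatype gp_vertex = U nat | V nat

definition petersen :: "nat \<Rightarrow> nat \<Rightarrow> gp_vertex graph" where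
  "petersen n k =
     (U ` {0..<n} \<union> V ` {0..<n},
      (\<Union>i \<in> {0..<n}. {{U i, U ((i + 1) mod n)}, {U i, V i}, {V i, V ((i + k) mod n)}}))"

lemma simple_graph_finite_edges:
  assumes "simple_graph G"
  shows "finite (snd G)"
  using assms by (auto simp: simple_graph_def intro: finite_subset[of _ "Pow (fst G)"])

lemma rna_values_finite:
  assumes "simple_graph G"
  shows "finite {card (parity_cut G f) | f. bij_betw f (fst G) {1..card (fst G)}}"
proof (rule finite_subset)
  show "{card (parity_cut G f) | f. bij_betw f (fst G) {1..card (fst G)}} \<subseteq> {..card (snd G)}"
    using simple_graph_finite_edges[OF assms]
    by (auto simp: parity_cut_def intro!: card_mono)
qed simp

lemma rna_attained:
  assumes "simple_graph G"
  shows "\<exists>f. bij_betw f (fst G) {1..card (fst G)} \<and> rna G = card (parity_cut G f)"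
proof -
  have "\<exists>f. bij_betw f (fst G) {1..card (fst G)}"
    using assms by (intro finite_same_card_bij) (auto simp: simple_graph_def)
  then have "rna G \<in> {card (parity_cut G f) | f. bij_betw f (fst G) {1..card (fst G)}}"
    unfolding rna_def using rna_values_finite[OF assms] by (intro Min_in) auto
  then show ?thesis by auto
qed

lemma rna_le:
  assumes "simple_graph G" "bij_betw f (fst G) {1..card (fst G)}"
  shows "rna G \<le> card (parity_cut G f)"
  unfolding rna_def using rna_values_finite[OF assms(1)] assms(2) by (intro Min_le) auto

lemma card_petersen_vertices: "card (fst (petersen n k)) = 2 * n"
proof -
  have "card (U ` {0..<n} \<union> V ` {0..<n}) = card (U ` {0..<n}) + card (V ` {0..<n})"
    by (intro card_Un_disjoint) auto
  then show ?thesis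
    by (simp add: petersen_def card_image inj_on_def)
qed

lemma simple_graph_petersen:
  assumes "n \<ge> 3" "k \<ge> 1" "2 * k < n"
  shows "simple_graph (petersen n k)"
proof -
  have *: "(i + j) mod n \<noteq> i" if "i < n" "1 \<le> j" "j < n" for i j
    using that by (cases "i + j < n") (auto simp: mod_if)
  have "i \<noteq> Suc i mod n" "i \<noteq> (i + k) mod n" if "i < n" for i
    using *[OF that, of 1] *[OF that, of k] assms by auto
  then show ?thesis
    using assms by (auto simp: simple_graph_def petersen_def card_insert_if)
qed

end

theory Submission
  imports Defs "HOL-Number_Theory.Cong"
begin

text \<open>A bijective labelling splits the \<open>2n\<close> vertices into two parity classes of size \<open>n\<close>.
  If all outer or all inner vertices have the same parity, balance forces all \<open>n \<ge> 5\<close> spokes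
  into the cut. Otherwise the outer cycle and the inner cycle (a single cycle, as
  \<open>gcd n k = 1\<close>) are each cut at least twice. So a cut of size at most four contains no spoke and
  exactly two edges of each cycle; then the even outer indices form an arc of length \<open>n / 2\<close>,
  and the inner indices agree with them. Since \<open>2 \<le> k < n / 2\<close>, shifting this arc by \<open>k\<close> changes
  membership at more than two indices, a contradiction. Giving all outer vertices odd labels and
  all inner ones even labels cuts precisely the spokes.\<close>

definition shift_changes :: "nat \<Rightarrow> nat \<Rightarrow> (nat \<Rightarrow> bool) \<Rightarrow> nat set" where
  "shift_changes n s c = {i. i < n \<and> c i \<noteq> c ((i + s) mod n)}"

lemma finite_shift_changes [simp]: "finite (shift_changes n s c)"
  by (simp add: shift_changes_def)

lemma inj_on_shift_mod: "inj_on (\<lambda>j. (p + j) mod n) {..<n}" for n :: nat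
proof (rule inj_onI)
  fix x y assume "x \<in> {..<n}" "y \<in> {..<n}" "(p + x) mod n = (p + y) mod n"
  then have "[p + x = p + y] (mod n)" by (simp add: cong_def)
  then have "[x = y] (mod n)" by (simp add: cong_add_lcancel_nat)
  then show "x = y" using \<open>x \<in> _\<close> \<open>y \<in> _\<close> by (simp add: cong_def)
qed

lemma shift_mod_image: "(\<lambda>j. (p + j) mod n) ` {..<n} = {..<n}" for n :: nat
  by (rule endo_inj_surj[OF _ _ inj_on_shift_mod]) (auto intro: mod_less_divisor)

lemma shift_closed_imp_all:
  fixes n s :: nat
  assumes "coprime s n" and closed: "\<And>i. i < n \<Longrightarrow> c i \<Longrightarrow> c ((i + s) mod n)"
    and "i < n" "c i" "t < n"
  shows "c t"
proof -
  have orbit: "c ((i + j * s) mod n)" for j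
  proof (induction j)
    case 0
    then show ?case using assms by simp
  next
    case (Suc j)
    have "c (((i + j * s) mod n + s) mod n)"
      using Suc assms(3) by (intro closed) auto
    moreover have "((i + j * s) mod n + s) mod n = (i + Suc j * s) mod n"
      by (simp add: mod_add_left_eq add.assoc add.commute[of s])
    ultimately show ?case by simp
  qed
  obtain x where x: "[s * x = 1] (mod n)"
    using cong_solve_coprime_nat[OF assms(1)] by auto
  have "[i + (x * (t + (n - i))) * s = i + (s * x) * (t + (n - i))] (mod n)"
    by (simp add: algebra_simps)
  also have "[i + (s * x) * (t + (n - i)) = i + 1 * (t + (n - i))] (mod n)"
    using x by (intro cong_add cong_mult) auto
  also have "i + 1 * (t + (n - i)) = t + n" using assms(3) by simp
  finally have "(i + (x * (t + (n - i))) * s) mod n = t"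
    using assms(5) by (simp add: cong_def)
  then show ?thesis using orbit by metis
qed

lemma shift_changes_both_ways:
  fixes n s :: nat
  assumes "coprime s n" "i < n" "c i" "j < n" "\<not> c j"
  obtains p q where "p < n" "c p" "\<not> c ((p + s) mod n)" "q < n" "\<not> c q" "c ((q + s) mod n)"
proof -
  have "\<exists>p<n. c p \<and> \<not> c ((p + s) mod n)"
    using shift_closed_imp_all[of s n c i j] assms by blast
  moreover have "\<exists>q<n. \<not> c q \<and> c ((q + s) mod n)"
    using shift_closed_imp_all[of s n "\<lambda>i. \<not> c i" j i] assms by blast
  ultimately show ?thesis using that by blast
qed

lemma card_shift_changes_ge_2:
  fixes n s :: nat
  assumes "coprime s n" "i < n" "c i" "j < n" "\<not> c j"
  shows "2 \<le> card (shift_changes n s c)"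
proof -
  obtain p q where "p < n" "c p" "\<not> c ((p + s) mod n)" "q < n" "\<not> c q" "c ((q + s) mod n)"
    using shift_changes_both_ways[OF assms] .
  then have "{p, q} \<subseteq> shift_changes n s c" "card {p, q} = 2"
    by (auto simp: shift_changes_def card_insert_if)
  then show ?thesis by (metis card_mono finite_shift_changes)
qed

lemma card_shift_changes_half_arc:
  fixes n k :: nat
  assumes "2 \<le> k" "2 * k < n" and half: "2 * card {i. i < n \<and> c i} = n"
    and two: "card (shift_changes n 1 c) \<le> 2"
  shows "3 \<le> card (shift_changes n k c)"
proof -
  have "card {i. i < n \<and> c i} \<noteq> card {}" "card {i. i < n \<and> c i} \<noteq> card {..<n}"
    using half assms(1,2) unfolding card.empty card_lessThan by linarith+
  then have "{i. i < n \<and> c i} \<noteq> {}" "{i. i < n \<and> c i} \<noteq> {..<n}" by metis+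
  then obtain i j where ij: "i < n" "c i" "j < n" "\<not> c j" by blast
  have "coprime 1 n" by simp
  then obtain p q where pq: "p < n" "c p" "\<not> c ((p + 1) mod n)" "q < n" "\<not> c q" "c ((q + 1) mod n)"
    using shift_changes_both_ways[OF _ ij] by blast
  have "{p, q} \<subseteq> shift_changes n 1 c" "card {p, q} = 2"
    using pq by (auto simp: shift_changes_def card_insert_if)
  then have D: "shift_changes n 1 c = {p, q}"
    using two card_seteq[of "shift_changes n 1 c" "{p, q}"] by simp
  define g where "g j = c ((p + j) mod n)" for j
  have "q \<in> (\<lambda>j. (p + j) mod n) ` {..<n}" using pq shift_mod_image by auto
  then obtain d where d: "d < n" "(p + d) mod n = q" by auto
  have g0: "g 0" using pq by (simp add: g_def)
  have step: "g (Suc j) = g j" if "j < n" "j \<noteq> 0" "j \<noteq> d" for j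
  proof -
    have "(p + j) mod n \<noteq> (p + 0) mod n" "(p + j) mod n \<noteq> (p + d) mod n"
      using that d inj_on_shift_mod[of p n, THEN inj_on_eq_iff, of j 0]
        inj_on_shift_mod[of p n, THEN inj_on_eq_iff, of j d] by simp_all
    then have "(p + j) mod n \<notin> shift_changes n 1 c" using D d pq by simp
    moreover have "(p + j) mod n < n" using pq by simp
    ultimately have "c ((p + j) mod n) = c (((p + j) mod n + 1) mod n)"
      by (auto simp: shift_changes_def)
    then show ?thesis by (simp add: g_def mod_Suc_eq)
  qed
  have gF: "\<not> g (Suc j)" if "Suc j \<le> d" for j
    using that
  proof (induction j)
    case 0
    then show ?case using pq by (simp add: g_def)
  next
    case (Suc j)
    then show ?case using step[of "Suc j"] d by simp
  qed
  have gT: "g (Suc d + j)" if "Suc d + j \<le> n" for j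
    using that
  proof (induction j)
    case 0
    have "((p + d) mod n + 1) mod n = (p + Suc d) mod n" by (simp add: mod_Suc_eq)
    then show ?case using pq d by (simp add: g_def)
  next
    case (Suc j)
    then show ?case using step[of "Suc d + j"] by simp
  qed
  have F: "\<not> g j" if "0 < j" "j \<le> d" for j
    using gF[of "j - 1"] that by simp
  have T: "g j" if "d < j" "j \<le> n" for j
    using gT[of "j - Suc d"] that by simp
  have "{i. i < n \<and> c i} = (\<lambda>j. (p + j) mod n) ` {j. j < n \<and> g j}"
  proof (intro equalityI subsetI)
    fix x assume x: "x \<in> {i. i < n \<and> c i}"
    then have "x \<in> (\<lambda>j. (p + j) mod n) ` {..<n}" by (simp only: shift_mod_image) simp
    then show "x \<in> (\<lambda>j. (p + j) mod n) ` {j. j < n \<and> g j}" using x by (auto simp: g_def)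
  qed (use pq in \<open>auto simp: g_def\<close>)
  then have "card {i. i < n \<and> c i} = card {j. j < n \<and> g j}"
    using card_image[OF inj_on_subset[OF inj_on_shift_mod]]
    by (metis (no_types, lifting) lessThan_iff mem_Collect_eq subsetI)
  also have "{j. j < n \<and> g j} = insert 0 {d<..<n}"
    using F T g0 d by (auto simp: not_less[symmetric]) (metis not_less gr0I)
  also have "card \<dots> = n - d" using d by simp
  finally have nd: "n = 2 * d" using half d by simp
  then have kd: "k < d" using assms by simp
  have change: "(p + j) mod n \<in> shift_changes n k c" if "g j \<noteq> g (j + k)" for j
    using that pq by (simp add: shift_changes_def g_def mod_add_left_eq add.assoc)
  have "(\<lambda>j. (p + j) mod n) ` {0, d - 1, d} \<subseteq> shift_changes n k c"
    using change[of 0] change[of "d - 1"] change[of d] g0 F[of k] F[of "d - 1"] F[of d]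
      T[of "d - 1 + k"] T[of "d + k"] kd nd assms(1) by auto
  moreover have "card ((\<lambda>j. (p + j) mod n) ` {0, d - 1, d}) = card {0, d - 1, d}"
    using d kd by (intro card_image inj_on_subset[OF inj_on_shift_mod]) auto
  moreover have "card {0, d - 1, d} = 3" using kd assms(1) by (simp add: card_insert_if)
  ultimately show ?thesis by (metis card_mono finite_shift_changes)
qed

lemma balanced_shift_changes_ge_5:
  fixes n k :: nat
  assumes "n \<ge> 5" "k \<ge> 2" "2 * k < n" "coprime k n"
    and bal: "card {i. i < n \<and> a i} + card {i. i < n \<and> b i} = n"
  shows "5 \<le> card (shift_changes n 1 a) + card {i. i < n \<and> a i \<noteq> b i} + card (shift_changes n k b)"
proof (rule ccontr)
  assume "\<not> ?thesis"
  then have small: "card (shift_changes n 1 a) + card {i. i < n \<and> a i \<noteq> b i}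
      + card (shift_changes n k b) \<le> 4" by simp
  have full: "P i" if "card {i. i < n \<and> P i} = n" "i < n" for P i
  proof -
    have "{i. i < n \<and> P i} = {..<n}" using that by (intro card_subset_eq) auto
    then show ?thesis using that by auto
  qed
  have none: "\<not> P i" if "card {i. i < n \<and> P i} = 0" "i < n" for P i
    using that by auto
  have all_card: "card {i. i < n \<and> P i} = n" if "\<And>i. i < n \<Longrightarrow> P i" for P
  proof -
    have "{i. i < n \<and> P i} = {..<n}" using that by auto
    then show ?thesis by simp
  qed
  have none_card: "card {i. i < n \<and> P i} = 0" if "\<And>i. i < n \<Longrightarrow> \<not> P i" for P
    using that by auto
  have not_all_spokes: "\<not> (\<forall>i<n. a i \<noteq> b i)"
    using small assms(1) all_card[of "\<lambda>i. a i \<noteq> b i"] by auto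
  have a1: "\<exists>i<n. a i"
  proof (rule ccontr)
    assume none_such: "\<not> ?thesis"
    then have "card {i. i < n \<and> a i} = 0" by (intro none_card) blast
    then have "card {i. i < n \<and> b i} = n" using bal by linarith
    then show False using full[of b] none_such not_all_spokes by blast
  qed
  have a2: "\<exists>i<n. \<not> a i"
  proof (rule ccontr)
    assume none_such: "\<not> ?thesis"
    then have "card {i. i < n \<and> a i} = n" by (intro all_card) blast
    then have "card {i. i < n \<and> b i} = 0" using bal by linarith
    then show False using none[of b] none_such not_all_spokes by blast
  qed
  have b1: "\<exists>i<n. b i"
  proof (rule ccontr)
    assume none_such: "\<not> ?thesis"
    then have "card {i. i < n \<and> b i} = 0" by (intro none_card) blast
    then have "card {i. i < n \<and> a i} = n" using bal by linarith
    then show False using full[of a] none_such not_all_spokes by blast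
  qed
  have b2: "\<exists>i<n. \<not> b i"
  proof (rule ccontr)
    assume none_such: "\<not> ?thesis"
    then have "card {i. i < n \<and> b i} = n" by (intro all_card) blast
    then have "card {i. i < n \<and> a i} = 0" using bal by linarith
    then show False using none[of a] none_such not_all_spokes by blast
  qed
  have A: "2 \<le> card (shift_changes n 1 a)"
    using a1 a2 card_shift_changes_ge_2[of 1 n _ a] by auto
  have B: "2 \<le> card (shift_changes n k b)"
    using b1 b2 card_shift_changes_ge_2[of k n _ b] assms(4) by auto
  have "card {i. i < n \<and> a i \<noteq> b i} = 0" using small A B by linarith
  then have eq: "a i = b i" if "i < n" for i
    using none[of "\<lambda>i. a i \<noteq> b i"] that by blast
  then have "{i. i < n \<and> a i} = {i. i < n \<and> b i}" by auto
  moreover have "shift_changes n 1 a = shift_changes n 1 b"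
    using eq by (auto simp: shift_changes_def)
  ultimately have "3 \<le> card (shift_changes n k b)"
    using card_shift_changes_half_arc[of k n b] assms small B bal by simp
  then show False using small A by simp
qed

lemma inj_on_shift_edges:
  fixes n s :: nat
  assumes "inj w" "2 * s < n" "0 < s"
  shows "inj_on (\<lambda>i. {w i, w ((i + s) mod n)}) {..<n}"
proof (rule inj_onI)
  fix x y
  assume xy: "x \<in> {..<n}" "y \<in> {..<n}" and "{w x, w ((x + s) mod n)} = {w y, w ((y + s) mod n)}"
  then have "x = y \<or> (x = (y + s) mod n \<and> y = (x + s) mod n)"
    using assms(1) by (auto simp: doubleton_eq_iff inj_eq)
  moreover have "(z + s) mod n = z + s \<or> (z + s) mod n + n = z + s" if "z < n" for z
    using that assms(2) by (cases "z + s < n") (auto simp: le_mod_geq)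
  ultimately have "x = y \<or> (x = y + s \<or> x + n = y + s) \<and> (y = x + s \<or> y + n = x + s)"
    using xy by (metis lessThan_iff)
  then show "x = y" using assms(2,3) by linarith
qed

lemma card_parity_cut_petersen_ge:
  fixes n k :: nat and f :: "gp_vertex \<Rightarrow> nat"
  assumes "n \<ge> 3" "k \<ge> 1" "2 * k < n"
  defines "a \<equiv> \<lambda>i. even (f (U i))" and "b \<equiv> \<lambda>i. even (f (V i))"
  shows "card (shift_changes n 1 a) + card {i. i < n \<and> a i \<noteq> b i} + card (shift_changes n k b)
    \<le> card (parity_cut (petersen n k) f)"
proof -
  let ?O = "(\<lambda>i. {U i, U ((i + 1) mod n)}) ` shift_changes n 1 a"
  let ?S = "(\<lambda>i. {U i, V i}) ` {i. i < n \<and> a i \<noteq> b i}"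
  let ?I = "(\<lambda>i. {V i, V ((i + k) mod n)}) ` shift_changes n k b"
  have sub: "shift_changes n s c \<subseteq> {..<n}" for s c by (auto simp: shift_changes_def)
  have "card ?O = card (shift_changes n 1 a)"
    using assms by (intro card_image inj_on_subset[OF inj_on_shift_edges sub]) (auto simp: inj_def)
  moreover have "card ?I = card (shift_changes n k b)"
    using assms by (intro card_image inj_on_subset[OF inj_on_shift_edges sub]) (auto simp: inj_def)
  moreover have "card ?S = card {i. i < n \<and> a i \<noteq> b i}"
    by (intro card_image) (auto simp: inj_on_def doubleton_eq_iff)
  moreover have "card (?O \<union> ?S \<union> ?I) = card ?O + card ?S + card ?I"
  proof -
    have "?O \<inter> ?S = {}" "(?O \<union> ?S) \<inter> ?I = {}" by (auto simp: doubleton_eq_iff)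
    then show ?thesis by (simp add: card_Un_disjoint)
  qed
  moreover have "?O \<union> ?S \<union> ?I \<subseteq> parity_cut (petersen n k) f"
    unfolding parity_cut_def petersen_def shift_changes_def a_def b_def by fastforce
  moreover have "finite (parity_cut (petersen n k) f)"
    using simple_graph_finite_edges[OF simple_graph_petersen[of n k]] assms
    by (simp add: parity_cut_def)
  ultimately show ?thesis
    using card_mono[of "parity_cut (petersen n k) f" "?O \<union> ?S \<union> ?I"] by linarith
qed

lemma card_even_upto_double: "card {m \<in> {1..2 * n}. even m} = n" for n :: nat
proof -
  have "{m \<in> {1..2 * n}. even m} = (\<lambda>j. 2 * j) ` {1..n}" by (auto elim!: evenE)
  then show ?thesis by (simp add: card_image inj_on_def)
qed

lemma petersen_labelling_balanced:
  assumes "bij_betw f (fst (petersen n k)) {1..card (fst (petersen n k))}"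
  shows "card {i. i < n \<and> even (f (U i))} + card {i. i < n \<and> even (f (V i))} = n"
proof -
  let ?A = "{i. i < n \<and> even (f (U i))}" and ?B = "{i. i < n \<and> even (f (V i))}"
  have bij: "bij_betw f (U ` {0..<n} \<union> V ` {0..<n}) {1..2 * n}"
    using assms unfolding card_petersen_vertices by (simp add: petersen_def)
  have "f ` (U ` ?A \<union> V ` ?B) = {m \<in> f ` (U ` {0..<n} \<union> V ` {0..<n}). even m}" by auto
  then have "f ` (U ` ?A \<union> V ` ?B) = {m \<in> {1..2 * n}. even m}"
    by (simp only: bij_betw_imp_surj_on[OF bij])
  moreover have "inj_on f (U ` ?A \<union> V ` ?B)"
    by (rule inj_on_subset[OF bij_betw_imp_inj_on[OF bij]]) auto
  ultimately have "card (U ` ?A \<union> V ` ?B) = n"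
    using card_image[of f "U ` ?A \<union> V ` ?B"] card_even_upto_double[of n] by simp
  moreover have "card (U ` ?A \<union> V ` ?B) = card (U ` ?A) + card (V ` ?B)"
    by (intro card_Un_disjoint) auto
  ultimately show ?thesis by (simp add: card_image inj_on_def)
qed

lemma rna_petersen_le:
  assumes "n \<ge> 3" "k \<ge> 1" "2 * k < n"
  shows "rna (petersen n k) \<le> n"
proof -
  define f where "f = (\<lambda>x. case x of U i \<Rightarrow> 2 * i + 1 | V i \<Rightarrow> 2 * i + 2)"
  have fU: "f (U i) = 2 * i + 1" and fV: "f (V i) = 2 * i + 2" for i by (simp_all add: f_def)
  let ?W = "U ` {0..<n} \<union> V ` {0..<n}"
  have "inj_on f ?W"
  proof (rule inj_onI)
    fix x y assume "f x = f y"
    then show "x = y" by (cases x; cases y) (simp_all add: fU fV, presburger+)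
  qed
  moreover have "f ` ?W \<subseteq> {1..2 * n}" by (auto simp: fU fV)
  moreover have "card ?W = 2 * n" using card_petersen_vertices[of n k] by (simp add: petersen_def)
  ultimately have "bij_betw f ?W {1..2 * n}"
    by (simp add: bij_betw_def card_image card_subset_eq)
  then have "bij_betw f (fst (petersen n k)) {1..card (fst (petersen n k))}"
    unfolding card_petersen_vertices by (simp add: petersen_def)
  then have "rna (petersen n k) \<le> card (parity_cut (petersen n k) f)"
    by (rule rna_le[OF simple_graph_petersen[OF assms]])
  also have "parity_cut (petersen n k) f \<subseteq> (\<lambda>i. {U i, V i}) ` {0..<n}"
  proof
    fix e assume "e \<in> parity_cut (petersen n k) f"
    then obtain u v i where e: "e = {u, v}" "even (f u) \<noteq> even (f v)" and "i < n"
      and "e \<in> {{U i, U ((i + 1) mod n)}, {U i, V i}, {V i, V ((i + k) mod n)}}"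
      unfolding parity_cut_def petersen_def snd_conv mem_Collect_eq UN_iff Bex_def
        atLeastLessThan_iff by metis
    moreover have "e \<noteq> {U x, U y}" "e \<noteq> {V x, V y}" for x y
      using e by (auto simp: doubleton_eq_iff fU fV)
    ultimately show "e \<in> (\<lambda>i. {U i, V i}) ` {0..<n}" by auto
  qed
  then have "card (parity_cut (petersen n k) f) \<le> n"
    using surj_card_le[of "{0..<n}" "parity_cut (petersen n k) f"] by simp
  finally show ?thesis .
qed

theorem theorem4p3:
  fixes n k :: nat
  assumes "n \<ge> 5" and "k \<ge> 2" and "2 * k < n" and "gcd n k = 1"
  shows "5 \<le> rna (petersen n k) \<and> rna (petersen n k) \<le> n"
proof
  have "simple_graph (petersen n k)" using assms by (intro simple_graph_petersen) auto
  then obtain f where f: "bij_betw f (fst (petersen n k)) {1..card (fst (petersen n k))}"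
    and rna: "rna (petersen n k) = card (parity_cut (petersen n k) f)"
    using rna_attained by blast
  have "coprime k n" using assms(4) by (simp add: coprime_iff_gcd_eq_1 gcd.commute)
  from balanced_shift_changes_ge_5[OF assms(1-3) this petersen_labelling_balanced[OF f]]
  show "5 \<le> rna (petersen n k)"
    unfolding rna using card_parity_cut_petersen_ge[of n k f] assms by simp
  show "rna (petersen n k) \<le> n" using assms by (intro rna_petersen_le) auto
qed

end
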